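(* Consider the control-affine system $\dot x=a(x)+g(x)u$, with $a:\mathbb{R}^n\to\mathbb{R}^n$ and $g:\mathbb{R}^n\to\mathbb{R}^{n\times m}$ locally Lipschitz, and let $\mathcal{C}\subset\mathbb{R}^n$ with $\mathbf{0}_n\in\mathrm{Int}(\mathcal{C})$. Let $\Gamma\subseteq\mathbb{R}^n$ be an open set with $\mathcal{C}\subseteq\Gamma$, let $h$ be an eCBF of $\mathcal{C}$ with $0$ as a regular value, and let $V$ be a CLF on $\Gamma$. Let $$\mathcal{P}:=\{x\in\Gamma: L_gV(x)=\kappa L_gh(x)\text{ for some }\kappa>0\},$$ and assume that $$\mathcal{P}\cap\partial\mathcal{C}\subseteq\Big\{x\in\partial\mathcal{C}: L_gh(x)\ne\mathbf{0}_m,\ L_aV(x)<\frac{L_gV(x)^TL_gh(x)}{\|L_gh(x)\|^2}L_ah(x)\Big\}.$$ Then there exists a compatible CLF-eCBF pair in $\mathcal{C}$ with $0$ a regular value of the eCBF.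
   Context: Write $f(x,u)=a(x)+g(x)u$. For differentiable $U$, $L_aU(x)=\nabla U(x)^Ta(x)\in\mathbb{R}$ and $L_gU(x)\in\mathbb{R}^m$ is the vector with entries those of $\nabla U(x)^Tg(x)$. $0$ is a regular value of $h$ if $\nabla h(x)\ne0$ for all $x$ with $h(x)=0$. A function $V$ is positive definite if $V(0)=0$ and $V(x)>0$ for $x\ne0$; it is proper in $\Gamma$ if $\{x\in\Gamma:V(x)\le c\}$ is compact for every $c\ge0$. A continuous $\alpha:\mathbb{R}\times\mathbb{R}_{\ge0}\to\mathbb{R}$ is of extended class $\mathcal{K}_\infty\mathcal{K}$ if $\alpha(\cdot,s)$ is strictly increasing for all $s\ge0$, $\alpha(r,\cdot)$ is strictly increasing for all $r>0$, $\alpha(0,s)=0$ for all $s\ge0$, and $\lim_{r\to\pm\infty}\alpha(r,s)=\pm\infty$ for all $s\ge0$. CLF. Given $\Gamma\subseteq\mathbb{R}^n$ with $\mathbf{0}_n\in\Gamma$, a continuously differentiable $V:\Gamma\to\mathbb{R}$ is a control Lyapunov function (CLF) on $\Gamma$ if it is proper in $\Gamma$, positive definite, and there exists a positive definite $W:\Gamma\to\mathbb{R}$ such that for each $x\in\Gamma\setminus\{0\}$ there exists $u\in\mathbb{R}^m$ with (CLF inequality) $\nabla V(x)^Tf(x,u)\le-W(x)$. eCBF. A continuously differentiable $h:\mathbb{R}^n\to\mathbb{R}$ with $\mathcal{C}=\{h\ge0\}$, $\partial\mathcal{C}=\{h=0\}$, $\mathrm{Int}(\mathcal{C})=\{h>0\}\neq\emptyset$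 is an extended control barrier function (eCBF) of $\mathcal{C}$ if there is an extended class $\mathcal{K}_\infty\mathcal{K}$ function $\alpha$ such that for all $x\in\mathcal{C}$ there is $u\in\mathbb{R}^m$ with (eCBF inequality) $\nabla h(x)^Tf(x,u)\ge-\alpha(h(x),\|x\|)$. Compatibility. A CLF $V$ on an open set containing $\mathcal{C}$ (with associated $W$) and an eCBF $h$ of $\mathcal{C}$ (with associated $\alpha$) are a compatible CLF-eCBF pair in $\mathcal{C}$ if for every $x\in\mathcal{C}$ there exists $u\in\mathbb{R}^m$ satisfying the CLF inequality and the eCBF inequality simultaneously (with $W$ and $\alpha$ not depending on $x$). *)

theory Defs
  imports "HOL-Analysis.Analysis"
begin

definition gradient :: "('a::euclidean_space \<Rightarrow> real) \<Rightarrow> 'a \<Rightarrow> 'a" where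
  "gradient U x = (THE D. GDERIV U x :> D)"

lemma gradient_GDERIV:
  fixes U :: "'a::euclidean_space \<Rightarrow> real"
  assumes "U differentiable (at x)"
  shows "GDERIV U x :> gradient U x"
proof -
  obtain f' where f': "(U has_derivative f') (at x)"
    using assms by (auto simp: differentiable_def)
  interpret bounded_linear f' using f' by (rule has_derivative_bounded_linear)
  have "f' = (\<lambda>h. inner h (adjoint f' 1))"
    using adjoint_works[OF linear_axioms, of _ 1] by (auto simp: fun_eq_iff)
  then have ex: "GDERIV U x :> adjoint f' 1"
    using f' by (simp add: gderiv_def)
  have "D = E" if "GDERIV U x :> D" "GDERIV U x :> E" for D E
  proof -
    have "(\<lambda>h. inner h D) = (\<lambda>h. inner h E)"
      using that unfolding gderiv_def by (rule has_derivative_unique)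
    then show ?thesis by (metis inner_commute vector_eq_rdot)
  qed
  then show ?thesis
    unfolding gradient_def using ex by (metis (mono_tags, lifting) theI)
qed

text \<open>
  Functions defined on a subset \<open>\<Gamma>\<close> of the state space are represented by total functions that
  are constrained on \<open>\<Gamma>\<close> only.  Since the derivative is the one at the full neighbourhood filter,
  continuous differentiability on \<open>\<Gamma>\<close> has its usual meaning for open \<open>\<Gamma>\<close>, and the sets on which
  it is used below are open.
\<close>

definition C1_on :: "'a::euclidean_space set \<Rightarrow> ('a \<Rightarrow> real) \<Rightarrow> bool" where
  "C1_on S U \<longleftrightarrow> (\<forall>x\<in>S. U differentiable (at x)) \<and> continuous_on S (gradient U)"

definition locally_lipschitz :: "('a::metric_space \<Rightarrow> 'b::metric_space) \<Rightarrow> bool" where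
  "locally_lipschitz F \<longleftrightarrow> (\<forall>x. \<exists>r>0. \<exists>L. L-lipschitz_on (cball x r) F)"

definition regular_value_0 :: "('a::euclidean_space \<Rightarrow> real) \<Rightarrow> bool" where
  "regular_value_0 h \<longleftrightarrow> (\<forall>x. h x = 0 \<longrightarrow> gradient h x \<noteq> 0)"

definition control_affine ::
    "(real^'n \<Rightarrow> real^'n) \<Rightarrow> (real^'n \<Rightarrow> real^'m^'n) \<Rightarrow> real^'n \<Rightarrow> real^'m \<Rightarrow> real^'n" where
  "control_affine a g x u = a x + g x *v u"

definition lie_a :: "(real^'n \<Rightarrow> real^'n) \<Rightarrow> (real^'n \<Rightarrow> real) \<Rightarrow> real^'n \<Rightarrow> real" where
  "lie_a a U x = gradient U x \<bullet> a x"

definition lie_g :: "(real^'n \<Rightarrow> real^'m^'n) \<Rightarrow> (real^'n \<Rightarrow> real) \<Rightarrow> real^'n \<Rightarrow> real^'m" where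
  "lie_g g U x = gradient U x v* g x"

definition positive_definite_on :: "'a::zero set \<Rightarrow> ('a \<Rightarrow> real) \<Rightarrow> bool" where
  "positive_definite_on \<Gamma> V \<longleftrightarrow> V 0 = 0 \<and> (\<forall>x\<in>\<Gamma>. x \<noteq> 0 \<longrightarrow> V x > 0)"

definition proper_in :: "'a::topological_space set \<Rightarrow> ('a \<Rightarrow> real) \<Rightarrow> bool" where
  "proper_in \<Gamma> V \<longleftrightarrow> (\<forall>c\<ge>0. compact {x\<in>\<Gamma>. V x \<le> c})"

definition extended_class_KinfK :: "(real \<Rightarrow> real \<Rightarrow> real) \<Rightarrow> bool" where
  "extended_class_KinfK \<alpha> \<longleftrightarrow>
     continuous_on (UNIV \<times> {0..}) (\<lambda>(r, s). \<alpha> r s) \<and>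
     (\<forall>s\<ge>0. strict_mono (\<lambda>r. \<alpha> r s)) \<and>
     (\<forall>r>0. strict_mono_on {0..} (\<alpha> r)) \<and>
     (\<forall>s\<ge>0. \<alpha> 0 s = 0) \<and>
     (\<forall>s\<ge>0. filterlim (\<lambda>r. \<alpha> r s) at_top at_top \<and> filterlim (\<lambda>r. \<alpha> r s) at_bot at_bot)"

definition clf_ineq ::
    "(real^'n \<Rightarrow> real^'n) \<Rightarrow> (real^'n \<Rightarrow> real^'m^'n) \<Rightarrow> (real^'n \<Rightarrow> real) \<Rightarrow> (real^'n \<Rightarrow> real)
     \<Rightarrow> real^'n \<Rightarrow> real^'m \<Rightarrow> bool" where
  "clf_ineq a g V W x u \<longleftrightarrow> gradient V x \<bullet> control_affine a g x u \<le> - W x"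

definition ecbf_ineq ::
    "(real^'n \<Rightarrow> real^'n) \<Rightarrow> (real^'n \<Rightarrow> real^'m^'n) \<Rightarrow> (real^'n \<Rightarrow> real) \<Rightarrow> (real \<Rightarrow> real \<Rightarrow> real)
     \<Rightarrow> real^'n \<Rightarrow> real^'m \<Rightarrow> bool" where
  "ecbf_ineq a g h \<alpha> x u \<longleftrightarrow> gradient h x \<bullet> control_affine a g x u \<ge> - \<alpha> (h x) (norm x)"

text \<open>The \<open>_with\<close> versions record the function \<open>W\<close>, respectively \<open>\<alpha>\<close>, associated with \<open>V\<close>,
  respectively \<open>h\<close>.\<close>

definition is_clf_with ::
    "(real^'n \<Rightarrow> real^'n) \<Rightarrow> (real^'n \<Rightarrow> real^'m^'n) \<Rightarrow> (real^'n) set \<Rightarrow> (real^'n \<Rightarrow> real)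
     \<Rightarrow> (real^'n \<Rightarrow> real) \<Rightarrow> bool" where
  "is_clf_with a g \<Gamma> V W \<longleftrightarrow>
     0 \<in> \<Gamma> \<and> C1_on \<Gamma> V \<and> proper_in \<Gamma> V \<and> positive_definite_on \<Gamma> V \<and>
     positive_definite_on \<Gamma> W \<and> (\<forall>x\<in>\<Gamma> - {0}. \<exists>u. clf_ineq a g V W x u)"

definition is_clf ::
    "(real^'n \<Rightarrow> real^'n) \<Rightarrow> (real^'n \<Rightarrow> real^'m^'n) \<Rightarrow> (real^'n) set \<Rightarrow> (real^'n \<Rightarrow> real) \<Rightarrow> bool"
  where
  "is_clf a g \<Gamma> V \<longleftrightarrow> (\<exists>W. is_clf_with a g \<Gamma> V W)"

definition is_ecbf_with ::
    "(real^'n \<Rightarrow> real^'n) \<Rightarrow> (real^'n \<Rightarrow> real^'m^'n) \<Rightarrow> (real^'n) set \<Rightarrow> (real^'n \<Rightarrow> real)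
     \<Rightarrow> (real \<Rightarrow> real \<Rightarrow> real) \<Rightarrow> bool" where
  "is_ecbf_with a g C h \<alpha> \<longleftrightarrow>
     C1_on UNIV h \<and>
     C = {x. h x \<ge> 0} \<and> frontier C = {x. h x = 0} \<and> interior C = {x. h x > 0} \<and>
     interior C \<noteq> {} \<and>
     extended_class_KinfK \<alpha> \<and> (\<forall>x\<in>C. \<exists>u. ecbf_ineq a g h \<alpha> x u)"

definition is_ecbf ::
    "(real^'n \<Rightarrow> real^'n) \<Rightarrow> (real^'n \<Rightarrow> real^'m^'n) \<Rightarrow> (real^'n) set \<Rightarrow> (real^'n \<Rightarrow> real) \<Rightarrow> bool"
  where
  "is_ecbf a g C h \<longleftrightarrow> (\<exists>\<alpha>. is_ecbf_with a g C h \<alpha>)"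

definition compatible_pair ::
    "(real^'n \<Rightarrow> real^'n) \<Rightarrow> (real^'n \<Rightarrow> real^'m^'n) \<Rightarrow> (real^'n) set \<Rightarrow> (real^'n \<Rightarrow> real)
     \<Rightarrow> (real^'n \<Rightarrow> real) \<Rightarrow> bool" where
  "compatible_pair a g C V h \<longleftrightarrow>
     (\<exists>\<Gamma> W \<alpha>. open \<Gamma> \<and> C \<subseteq> \<Gamma> \<and> is_clf_with a g \<Gamma> V W \<and> is_ecbf_with a g C h \<alpha> \<and>
        (\<forall>x\<in>C. \<exists>u. clf_ineq a g V W x u \<and> ecbf_ineq a g h \<alpha> x u))"

definition lie_parallel_set ::
    "(real^'n \<Rightarrow> real^'m^'n) \<Rightarrow> (real^'n) set \<Rightarrow> (real^'n \<Rightarrow> real) \<Rightarrow> (real^'n \<Rightarrow> real)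
     \<Rightarrow> (real^'n) set" where
  "lie_parallel_set g \<Gamma> V h = {x\<in>\<Gamma>. \<exists>\<kappa>>0. lie_g g V x = \<kappa> *\<^sub>R lie_g g h x}"

end

theory Submission
  imports Defs
begin

text \<open>
  The pair that works is \<open>V\<close> itself together with a barrier \<open>h'\<close> that has the same zero and
  positive sets as \<open>h\<close> but is constant near the origin.  Everything rests on the freedom in the
  choice of \<open>W\<close> and \<open>\<alpha>\<close>.

  Since \<open>W\<close> only has to be positive definite, it may be chosen after the controls: the CLF
  inequality reduces to making the derivative of \<open>V\<close> strictly negative away from the origin
  (lemma \<open>clf_reassign_W\<close>).  What has to be found is an \<open>\<alpha>\<close> such that for every \<open>x\<close> in \<open>C\<close> some
  control makes \<open>V\<close> strictly decrease while \<open>h'\<close> decreases at rate at most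
  \<open>\<alpha>(h'(x), \<parallel>x\<parallel>)\<close>.  Call \<open>t\<close> admissible at \<open>x\<close> if such a control exists with \<open>t\<close> as the bound
  on the rate.  As the inequality for \<open>V\<close> is strict, a fixed control that is good at a point
  \<open>x \<noteq> 0\<close> remains good nearby, so every \<open>t\<close> above an admissible rate at \<open>x\<close> is admissible in a
  neighbourhood.  At the origin this argument breaks down, because the
  gradient of \<open>V\<close> vanishes there and the required controls may blow up; flattening \<open>h\<close> makes
  \<open>0\<close> admissible near the origin, whatever the control.

  On the boundary of \<open>C\<close> the rate \<open>0\<close> is admissible.  That is a statement about two half-spaces
  of controls (lemma \<open>strict_and_nonstrict_halfspace_intersect\<close>): they can miss each other only
  if their normals \<open>L\<^sub>gV\<close> and \<open>L\<^sub>gh\<close> are positive multiples of each other, and in this case the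
  hypothesis on \<open>\<P>\<close> is exactly the condition that they meet.

  Consequently the admissible rates are bounded on bounded parts of \<open>C\<close> and, there, can be taken
  arbitrarily small as \<open>h'\<close> tends to \<open>0\<close>.  Such rates are dominated by a product
  \<open>\<gamma>(h'(x)) \<psi>(\<parallel>x\<parallel>)\<close> of the required class (lemma \<open>extended_class_KinfK_majorant\<close>).
\<close>

section \<open>Gradients and the closed-loop derivative\<close>

lemma gradient_eqI:
  fixes U :: "'a::euclidean_space \<Rightarrow> real"
  assumes "GDERIV U x :> D"
  shows "gradient U x = D"
proof -
  have "U differentiable (at x)"
    using assms by (auto simp: gderiv_def differentiable_def)
  then have "(\<lambda>v. v \<bullet> gradient U x) = (\<lambda>v. v \<bullet> D)"
    using assms gradient_GDERIV unfolding gderiv_def by (blast intro: has_derivative_unique)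
  then show ?thesis
    by (metis inner_commute vector_eq_rdot)
qed

lemma gradient_control_affine:
  "gradient U x \<bullet> control_affine a g x u = lie_a a U x + lie_g g U x \<bullet> u"
  by (simp add: control_affine_def lie_a_def lie_g_def inner_add_right dot_lmul_matrix)

lemma locally_lipschitz_imp_continuous_on:
  assumes "locally_lipschitz F"
  shows "continuous_on S F"
proof -
  have "isCont F x" for x
  proof -
    obtain r L where r: "r > 0" "L-lipschitz_on (cball x r) F"
      using assms unfolding locally_lipschitz_def by blast
    then have "continuous_on (ball x r) F"
      by (meson ball_subset_cball continuous_on_subset lipschitz_on_continuous_on)
    then show ?thesis
      using r(1) by (simp add: continuous_on_eq_continuous_at)
  qed
  then show ?thesis
    by (simp add: continuous_at_imp_continuous_on)
qed

lemma continuous_on_closed_loop_derivative: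
  assumes "continuous_on S (gradient U)" "continuous_on S a" "continuous_on S g"
  shows "continuous_on S (\<lambda>x. gradient U x \<bullet> control_affine a g x u)"
proof -
  have "continuous_on S (\<lambda>x. g x *v u)"
    unfolding matrix_vector_mult_def using assms(3) by (intro continuous_intros)
  then show ?thesis
    unfolding control_affine_def using assms by (intro continuous_intros)
qed

section \<open>Compatibility at a single boundary point\<close>

text \<open>
  Write \<open>v\<close> and \<open>k\<close> for the normals.  If they are nonzero and not positively parallel,
  Cauchy-Schwarz is strict and the direction \<open>k / \<parallel>k\<parallel> - v / \<parallel>v\<parallel>\<close> decreases the first affine
  form and increases the second one, so a long step along it satisfies both inequalities.  If
  they are positively parallel, the control \<open>- (q / \<parallel>k\<parallel>\<^sup>2) k\<close> makes the second form vanish, and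
  the parallel hypothesis makes the first form negative there.  If one normal is zero, the
  corresponding half-space, being nonempty, is the whole space.
\<close>

lemma strict_and_nonstrict_halfspace_intersect:
  fixes v k :: "'a::real_inner" and p q :: real
  assumes strict: "\<exists>u. p + v \<bullet> u < 0" and nonstrict: "\<exists>u. q + k \<bullet> u \<ge> 0"
    and parallel: "\<And>\<kappa>. \<kappa> > 0 \<Longrightarrow> v = \<kappa> *\<^sub>R k \<Longrightarrow> k \<noteq> 0 \<and> p < (v \<bullet> k) / (norm k)\<^sup>2 * q"
  shows "\<exists>u. p + v \<bullet> u < 0 \<and> q + k \<bullet> u \<ge> 0"
proof (cases "v = 0 \<or> k = 0")
  case True
  then show ?thesis using strict nonstrict by auto
next
  case False
  then have v: "norm v > 0" and k: "norm k > 0" by auto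
  show ?thesis
  proof (cases "v \<bullet> k = norm v * norm k")
    case True
    then have "norm v *\<^sub>R k = norm k *\<^sub>R v"
      by (simp only: norm_cauchy_schwarz_eq)
    then have "v = inverse (norm k) *\<^sub>R (norm v *\<^sub>R k)"
      using k by simp
    then have "v = (norm v / norm k) *\<^sub>R k"
      by (simp add: divide_inverse_commute)
    moreover have "norm v / norm k > 0" using v k by simp
    ultimately have less: "p < (v \<bullet> k) / (norm k)\<^sup>2 * q"
      using parallel by blast
    define u where "u = - (q / (norm k)\<^sup>2) *\<^sub>R k"
    have "q + k \<bullet> u = 0"
      using k by (simp add: u_def power2_norm_eq_inner)
    moreover have "p + v \<bullet> u < 0"
      using less by (simp add: u_def mult.commute)
    ultimately show ?thesis by (intro exI[of _ u]) simp
  next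
    case neq: False
    have less: "v \<bullet> k < norm v * norm k"
      using norm_cauchy_schwarz[of v k] neq by simp
    define d where "d = k /\<^sub>R norm k - v /\<^sub>R norm v"
    have "v \<bullet> d = (v \<bullet> k) / norm k - norm v"
      using v by (simp add: d_def inner_diff_right divide_inverse_commute flip: power2_norm_eq_inner)
         (simp add: power2_eq_square)
    moreover have "(v \<bullet> k) / norm k < norm v"
      using less k by (simp add: field_simps)
    ultimately have vd: "v \<bullet> d < 0" by simp
    have "k \<bullet> d = norm k - (v \<bullet> k) / norm v"
      using k by (simp add: d_def inner_diff_right divide_inverse_commute inner_commute flip: power2_norm_eq_inner)
         (simp add: power2_eq_square)
    moreover have "(v \<bullet> k) / norm v < norm k"
      using less v by (simp add: field_simps)
    ultimately have kd: "k \<bullet> d > 0" by simp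
    define t where "t = (\<bar>p\<bar> + 1) / (- (v \<bullet> d)) + \<bar>q\<bar> / (k \<bullet> d)"
    have "t * (- (v \<bullet> d)) \<ge> (\<bar>p\<bar> + 1) / (- (v \<bullet> d)) * (- (v \<bullet> d))"
      unfolding t_def using vd kd by (intro mult_right_mono) auto
    moreover have "(\<bar>p\<bar> + 1) / (- (v \<bullet> d)) * (- (v \<bullet> d)) = \<bar>p\<bar> + 1"
      using vd by simp
    ultimately have "p + v \<bullet> (t *\<^sub>R d) < 0"
      by simp
    moreover have "t * (k \<bullet> d) \<ge> \<bar>q\<bar> / (k \<bullet> d) * (k \<bullet> d)"
      unfolding t_def using vd kd by (intro mult_right_mono) (auto intro: divide_nonneg_neg)
    then have "q + k \<bullet> (t *\<^sub>R d) \<ge> 0"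
      using kd by simp
    ultimately show ?thesis by blast
  qed
qed

section \<open>Flattening a function above a level\<close>

text \<open>
  The profile is the parabola \<open>r (2 c - r)\<close> up to its vertex at \<open>r = c\<close>, continued by its maximum
  value: it is continuously differentiable, its only zero is \<open>0\<close>, where it is regular,
  and its derivative vanishes above the level \<open>c\<close>.
\<close>

definition flatten :: "real \<Rightarrow> real \<Rightarrow> real" where
  "flatten c r = c\<^sup>2 - (max 0 (c - r))\<^sup>2"

lemma flatten_nonneg_iff:
  assumes "c > 0"
  shows "flatten c r \<ge> 0 \<longleftrightarrow> r \<ge> 0"
proof -
  have "flatten c r \<ge> 0 \<longleftrightarrow> max 0 (c - r) \<le> c"
    unfolding flatten_def using assms by (simp add: abs_le_square_iff flip: abs_le_square_iff)
  then show ?thesis using assms by auto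
qed

lemma flatten_eq_0_iff:
  assumes "c > 0"
  shows "flatten c r = 0 \<longleftrightarrow> r = 0"
proof -
  have "flatten c r = 0 \<longleftrightarrow> max 0 (c - r) = c"
    unfolding flatten_def using assms by (auto simp: power2_eq_iff_nonneg)
  then show ?thesis using assms by auto
qed

lemma DERIV_flatten: "DERIV (flatten c) r :> 2 * max 0 (c - r)"
proof -
  have sq: "DERIV (\<lambda>y::real. (max 0 y)\<^sup>2) y :> 2 * max 0 y" for y
  proof (cases y "0::real" rule: linorder_cases)
    case less
    have "DERIV (\<lambda>y::real. 0) y :> 0" by simp
    then have "DERIV (\<lambda>y::real. (max 0 y)\<^sup>2) y :> 0"
      by (rule has_field_derivative_transform_within_open[where S="{..<0}"]) (use less in auto)
    then show ?thesis using less by simp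
  next
    case greater
    have "DERIV (\<lambda>y::real. y\<^sup>2) y :> 2 * y" by (auto intro!: derivative_eq_intros)
    then have "DERIV (\<lambda>y::real. (max 0 y)\<^sup>2) y :> 2 * y"
      by (rule has_field_derivative_transform_within_open[where S="{0<..}"]) (use greater in auto)
    then show ?thesis using greater by simp
  next
    case equal
    have lim: "((\<lambda>h::real. \<bar>h\<bar>) \<longlongrightarrow> 0) (at 0)"
      by (intro tendsto_eq_intros) auto
    have "((\<lambda>h::real. (max 0 h)\<^sup>2 / h) \<longlongrightarrow> 0) (at 0)"
    proof (rule Lim_null_comparison[OF _ lim], intro always_eventually allI)
      show "norm ((max 0 h)\<^sup>2 / h) \<le> \<bar>h\<bar>" for h :: real
        by (cases "h > 0") (auto simp: power2_eq_square max_def)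
    qed
    then show ?thesis
      using equal by (simp add: DERIV_def)
  qed
  have "DERIV (\<lambda>r. c\<^sup>2 - (max 0 (c - r))\<^sup>2) r :> 2 * max 0 (c - r)"
    by (rule derivative_eq_intros DERIV_chain'[OF _ sq] refl | simp)+
  then show ?thesis
    by (simp add: flatten_def[abs_def])
qed

lemma GDERIV_flatten:
  fixes h :: "'a::euclidean_space \<Rightarrow> real"
  assumes "h differentiable (at x)"
  shows "GDERIV (\<lambda>x. flatten c (h x)) x :> (2 * max 0 (c - h x)) *\<^sub>R gradient h x"
  using GDERIV_DERIV_compose[OF gradient_GDERIV[OF assms] DERIV_flatten] .

section \<open>Extended class K-infinity-K majorants\<close>

text \<open>
  A failure at every scale would produce a sequence in \<open>S\<close> along which \<open>H\<close> tends to \<open>0\<close>; by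
  compactness it accumulates at a zero of \<open>H\<close>, near which \<open>Q\<close> holds.
\<close>

lemma eventually_on_compact_uniform:
  fixes H :: "'a::euclidean_space \<Rightarrow> real" and Q :: "'a \<Rightarrow> bool"
  assumes "compact S" and "continuous_on S H" and "\<And>x. x \<in> S \<Longrightarrow> H x \<ge> 0"
    and near: "\<And>x. x \<in> S \<Longrightarrow> H x = 0 \<Longrightarrow> \<forall>\<^sub>F y in nhds x. y \<in> S \<longrightarrow> Q y"
  shows "\<exists>d>0. \<forall>x\<in>S. H x < d \<longrightarrow> Q x"
proof (rule ccontr)
  assume "\<not> ?thesis"
  then have "\<forall>n::nat. \<exists>y\<in>S. H y < 1 / (real n + 1) \<and> \<not> Q y"
    by (metis zero_less_divide_1_iff of_nat_0_le_iff add_nonneg_pos zero_less_one)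
  then obtain y where y: "\<And>n. y n \<in> S" "\<And>n. H (y n) < 1 / (real n + 1)" "\<And>n. \<not> Q (y n)"
    by metis
  then obtain l r where l: "l \<in> S" "strict_mono r" "(y \<circ> r) \<longlonglongrightarrow> l"
    using assms(1) unfolding compact_def by blast
  have "(\<lambda>n. H (y (r n))) \<longlonglongrightarrow> H l"
    using continuous_on_tendsto_compose[OF assms(2) l(3) l(1)] y(1) by (simp add: o_def)
  moreover have "(\<lambda>n. 1 / (real (r n) + 1)) \<longlonglongrightarrow> 0"
    using LIMSEQ_subseq_LIMSEQ[OF LIMSEQ_inverse_real_of_nat l(2)]
    by (simp add: o_def inverse_eq_divide add.commute)
  ultimately have "H l \<le> 0"
    by (rule LIMSEQ_le) (use y(2) less_imp_le in blast)
  then have "\<forall>\<^sub>F x in nhds l. x \<in> S \<longrightarrow> Q x"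
    using near l(1) assms(3) by (simp add: order_antisym)
  then have "\<forall>\<^sub>F n in sequentially. y (r n) \<in> S \<longrightarrow> Q (y (r n))"
    using eventually_compose_filterlim[OF _ l(3)] by (simp add: o_def)
  then show False
    using y by (auto simp: eventually_sequentially)
qed

lemma locally_bounded_on_compact_uniform:
  fixes P :: "'a::metric_space \<Rightarrow> real \<Rightarrow> bool"
  assumes "compact S" and mono: "\<And>x s t. P x s \<Longrightarrow> s \<le> t \<Longrightarrow> P x t"
    and near: "\<And>x. x \<in> S \<Longrightarrow> \<exists>t. \<forall>\<^sub>F y in nhds x. y \<in> S \<longrightarrow> P y t"
  shows "\<exists>B\<ge>0. \<forall>x\<in>S. P x B"
proof (rule ccontr)
  assume "\<not> ?thesis"
  then have "\<forall>n::nat. \<exists>y\<in>S. \<not> P y (real n)"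
    by (metis of_nat_0_le_iff)
  then obtain y where y: "\<And>n. y n \<in> S" "\<And>n. \<not> P (y n) (real n)"
    by metis
  then obtain l r where l: "l \<in> S" "strict_mono r" "(y \<circ> r) \<longlonglongrightarrow> l"
    using assms(1) unfolding compact_def by blast
  obtain t where "\<forall>\<^sub>F x in nhds l. x \<in> S \<longrightarrow> P x t"
    using near l(1) by blast
  then have ev: "\<forall>\<^sub>F n in sequentially. y (r n) \<in> S \<longrightarrow> P (y (r n)) t"
    using eventually_compose_filterlim[OF _ l(3)] by (simp add: o_def)
  have "\<forall>\<^sub>F n in sequentially. real (r n) \<ge> t"
    using filterlim_compose[OF filterlim_real_sequentially filterlim_subseq[OF l(2)]]
    by (simp add: filterlim_at_top)
  then have "\<forall>\<^sub>F n in sequentially. False"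
    using ev by eventually_elim (use y mono in blast)
  then show False by simp
qed

text \<open>
  The sum of the ramps \<open>K j \<cdot> max 0 (s + 1 - j)\<close> is locally finite, hence continuous; the \<open>j\<close>-th
  ramp has reached the height \<open>K j\<close> at \<open>s = j\<close>.
\<close>

lemma strict_mono_function_above_nat_values:
  fixes K :: "nat \<Rightarrow> real"
  assumes "\<And>j. K j \<ge> 0"
  shows "\<exists>\<psi>::real\<Rightarrow>real. continuous_on UNIV \<psi> \<and> strict_mono \<psi> \<and> (\<forall>s\<ge>0. \<psi> s \<ge> 1) \<and>
           (\<forall>j s. real j \<le> s \<longrightarrow> K j \<le> \<psi> s)"
proof -
  define f where "f j s = K j * max 0 (s + 1 - real j)" for j s
  define \<psi> where "\<psi> s = 1 + s + (\<Sum>j. f j s)" for s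
  have f0: "f j s \<ge> 0" for j s
    using assms by (simp add: f_def)
  have fmono: "f j s \<le> f j t" if "s \<le> t" for j s t
    unfolding f_def using that assms by (intro mult_left_mono) auto
  have vanish: "f j s = 0" if "s < real N" "j \<notin> {..N}" for j s N
  proof -
    have "real N + 1 \<le> real j" using that(2) by simp
    then show ?thesis using that(1) by (simp add: f_def)
  qed
  have summ: "summable (\<lambda>j. f j s)" for s
  proof -
    obtain N where "s < real N" using reals_Archimedean2 by blast
    then show ?thesis
      using vanish by (intro summable_finite[of "{..N}"]) auto
  qed
  have "isCont \<psi> s" for s
  proof -
    obtain N where N: "s < real N" using reals_Archimedean2 by blast
    have "continuous_on {..<real N} (\<lambda>s. 1 + s + (\<Sum>j\<le>N. f j s))"
      unfolding f_def by (intro continuous_intros)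
    also have "?this \<longleftrightarrow> continuous_on {..<real N} \<psi>"
      unfolding \<psi>_def using vanish
      by (intro continuous_on_cong refl arg_cong2[where f="(+)"] suminf_finite[symmetric]) auto
    finally show ?thesis
      using N by (simp add: continuous_on_eq_continuous_at)
  qed
  moreover have "strict_mono \<psi>"
  proof (rule strict_monoI)
    fix s t :: real assume "s < t"
    then show "\<psi> s < \<psi> t"
      unfolding \<psi>_def using suminf_le[OF fmono summ summ, of s t] by simp
  qed
  moreover have "\<psi> s \<ge> 1" if "s \<ge> 0" for s
    unfolding \<psi>_def using suminf_nonneg[OF summ f0, of s] that by simp
  moreover have "K j \<le> \<psi> s" if "real j \<le> s" for j s
  proof -
    have "K j * 1 \<le> f j s"
      unfolding f_def using assms that by (intro mult_left_mono) auto
    also have "\<dots> \<le> (\<Sum>j. f j s)"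
      using sum_le_suminf[OF summ, of "{j}" s] f0 by simp
    also have "\<dots> \<le> \<psi> s"
      unfolding \<psi>_def using that by simp
    finally show ?thesis by simp
  qed
  ultimately show ?thesis
    by (intro exI[of _ \<psi>]) (auto simp: continuous_at_imp_continuous_on)
qed

text \<open>
  However fast the thresholds \<open>d k\<close> tend to \<open>0\<close>, the ramps of height \<open>(1/2)^k\<close> that level off at
  \<open>d k\<close> have a uniformly convergent sum.  The summand \<open>r\<close> makes it strictly increasing and
  unbounded in both directions.
\<close>

lemma strict_mono_function_above_dyadic_steps:
  fixes d :: "nat \<Rightarrow> real"
  assumes d: "\<And>k. d k > 0"
  shows "\<exists>\<gamma>::real\<Rightarrow>real. continuous_on UNIV \<gamma> \<and> strict_mono \<gamma> \<and> (\<forall>r\<le>0. \<gamma> r = r) \<and>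
           (\<forall>r. \<gamma> r \<ge> r) \<and> (\<forall>k r. d k \<le> r \<longrightarrow> (1/2)^k \<le> \<gamma> r)"
proof -
  define f where "f k r = (1/2)^k * min 1 (max 0 (r / d k))" for k r
  define \<gamma> where "\<gamma> r = r + (\<Sum>k. f k r)" for r
  have f0: "f k r \<ge> 0" for k r
    by (simp add: f_def)
  have f1: "f k r \<le> (1/2)^k" for k r
    unfolding f_def using mult_left_mono[of "min 1 (max 0 (r / d k))" 1 "(1/2)^k"] by simp
  have fmono: "f k s \<le> f k t" if "s \<le> t" for k s t
    unfolding f_def using that d[of k]
    by (intro mult_left_mono min.mono max.mono divide_right_mono) auto
  have geo: "summable (\<lambda>k. (1/2)^k :: real)"
    by (rule summable_geometric) simp
  have summ: "summable (\<lambda>k. f k r)" for r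
    using geo by (rule summable_comparison_test') (use f0 f1 in auto)
  have "continuous_on UNIV (\<lambda>r. \<Sum>k. f k r)"
  proof (rule uniform_limit_theorem)
    show "uniform_limit UNIV (\<lambda>n r. \<Sum>k<n. f k r) (\<lambda>r. \<Sum>k. f k r) sequentially"
      using geo by (intro Weierstrass_m_test) (use f0 f1 in auto)
    show "\<forall>\<^sub>F n in sequentially. continuous_on UNIV (\<lambda>r. \<Sum>k<n. f k r)"
      unfolding f_def using d by (intro always_eventually allI continuous_intros) (auto simp: less_imp_neq[symmetric])
  qed simp
  then have "continuous_on UNIV \<gamma>"
    unfolding \<gamma>_def by (intro continuous_intros)
  moreover have "strict_mono \<gamma>"
  proof (rule strict_monoI)
    fix s t :: real assume "s < t"
    then show "\<gamma> s < \<gamma> t"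
      unfolding \<gamma>_def using suminf_le[OF fmono summ summ, of s t] by simp
  qed
  moreover have "\<gamma> r = r" if "r \<le> 0" for r
  proof -
    have "f k r = 0" for k
      using divide_nonpos_pos[OF that d[of k]] by (simp add: f_def)
    then show ?thesis by (simp add: \<gamma>_def)
  qed
  moreover have ge: "\<gamma> r \<ge> r" for r
    unfolding \<gamma>_def using suminf_nonneg[OF summ f0, of r] by simp
  moreover have "(1/2)^k \<le> \<gamma> r" if "d k \<le> r" for k r
  proof -
    have "r > 0" using that d[of k] by simp
    have "r / d k \<ge> 1"
      using that d[of k] by simp
    then have "(1/2)^k = f k r"
      by (simp add: f_def)
    also have "\<dots> \<le> (\<Sum>k. f k r)"
      using sum_le_suminf[OF summ, of "{k}" r] f0 by simp
    also have "\<dots> \<le> \<gamma> r"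
      unfolding \<gamma>_def using \<open>r > 0\<close> by simp
    finally show ?thesis .
  qed
  ultimately show ?thesis
    by (intro exI[of _ \<gamma>]) blast
qed

lemma extended_class_KinfK_product:
  assumes "continuous_on UNIV \<gamma>" "strict_mono \<gamma>" "\<And>r. r \<le> 0 \<Longrightarrow> \<gamma> r = r" "\<And>r. \<gamma> r \<ge> r"
    and "continuous_on UNIV \<psi>" "strict_mono \<psi>" "\<And>s. s \<ge> 0 \<Longrightarrow> \<psi> s \<ge> 1"
  shows "extended_class_KinfK (\<lambda>r s. \<gamma> r * \<psi> s)"
proof -
  have cont: "continuous_on (UNIV \<times> {0..}) (\<lambda>(r, s). \<gamma> r * \<psi> s)"
    unfolding case_prod_beta
    by (intro continuous_intros continuous_on_compose2[OF assms(1)] continuous_on_compose2[OF assms(5)]) auto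
  have pos: "\<psi> s > 0" if "s \<ge> 0" for s
    using assms(7)[OF that] by simp
  have mono1: "strict_mono (\<lambda>r. \<gamma> r * \<psi> s)" if "s \<ge> 0" for s
    using assms(2) pos[OF that] by (simp add: strict_mono_def)
  have mono2: "strict_mono_on {0..} (\<lambda>s. \<gamma> r * \<psi> s)" if "r > 0" for r
  proof -
    have "\<gamma> r > 0" using assms(4)[of r] that by simp
    then show ?thesis using assms(6) by (simp add: strict_mono_def strict_mono_on_def)
  qed
  have top: "filterlim (\<lambda>r. \<gamma> r * \<psi> s) at_top at_top" if "s \<ge> 0" for s
  proof -
    have "filterlim \<gamma> at_top at_top"
      by (rule filterlim_at_top_mono[OF filterlim_ident]) (use assms(4) in auto)
    then show ?thesis
      using filterlim_tendsto_pos_mult_at_top[OF tendsto_const pos[OF that]] by (simp add: mult.commute)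
  qed
  have bot: "filterlim (\<lambda>r. \<gamma> r * \<psi> s) at_bot at_bot" if "s \<ge> 0" for s
  proof -
    have "filterlim (\<lambda>r. \<psi> s * r) at_bot at_bot"
      using filterlim_tendsto_pos_mult_at_bot[OF tendsto_const pos[OF that] filterlim_ident] .
    moreover have "\<forall>\<^sub>F r in at_bot. \<gamma> r * \<psi> s = \<psi> s * r"
      using eventually_le_at_bot[of "0::real"] by eventually_elim (simp add: assms(3))
    ultimately show ?thesis
      by (simp only: filterlim_cong[OF refl refl])
  qed
  show ?thesis
    unfolding extended_class_KinfK_def using cont mono1 mono2 top bot assms(3)[of 0] by simp
qed

text \<open>
  A product \<open>\<gamma>(H x) \<psi>(\<parallel>x\<parallel>)\<close> suffices although the rate at which admissible values tend to \<open>0\<close> with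
  \<open>H\<close> may depend on the radius, thanks to a diagonal choice of \<open>\<gamma>\<close>: the threshold \<open>d k\<close> is such
  that \<open>(1/2)^k\<close> is admissible where \<open>H < d k\<close> in the ball of radius \<open>k\<close>.  For points of norm at
  most \<open>j\<close> with \<open>H x\<close> between the thresholds of the steps \<open>k > j\<close> and \<open>k - 1\<close>, the admissible value
  \<open>(1/2)^(k - 1)\<close> is at most \<open>2 \<gamma>(H x)\<close>; if \<open>H x\<close> is above one of the first \<open>j\<close> thresholds, \<open>\<gamma>\<close> is
  bounded below.  In both cases a constant factor depending on \<open>j\<close> suffices, and \<open>\<psi>\<close> dominates
  these factors.
\<close>

lemma extended_class_KinfK_majorant:
  fixes H :: "'a::euclidean_space \<Rightarrow> real" and P :: "'a \<Rightarrow> real \<Rightarrow> bool"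
  assumes "closed C" and "continuous_on C H" and H0: "\<And>x. x \<in> C \<Longrightarrow> H x \<ge> 0"
    and mono: "\<And>x s t. P x s \<Longrightarrow> s \<le> t \<Longrightarrow> P x t"
    and bounded: "\<And>x. x \<in> C \<Longrightarrow> \<exists>t. \<forall>\<^sub>F y in nhds x. y \<in> C \<longrightarrow> P y t"
    and boundary: "\<And>x e. x \<in> C \<Longrightarrow> H x = 0 \<Longrightarrow> e > 0 \<Longrightarrow> \<forall>\<^sub>F y in nhds x. y \<in> C \<longrightarrow> P y e"
    and zero: "\<And>x. x \<in> C \<Longrightarrow> H x = 0 \<Longrightarrow> P x 0"
  shows "\<exists>\<alpha>. extended_class_KinfK \<alpha> \<and> (\<forall>x\<in>C. P x (\<alpha> (H x) (norm x)))"
proof -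
  define S where "S k = C \<inter> cball 0 (real k)" for k :: nat
  have S: "compact (S k)" for k
    unfolding S_def using assms(1) by (simp add: closed_Int_compact)
  have "\<exists>B\<ge>0. \<forall>x\<in>S k. P x B" for k
  proof (rule locally_bounded_on_compact_uniform[OF S mono])
    fix x assume "x \<in> S k"
    then obtain t where "\<forall>\<^sub>F y in nhds x. y \<in> C \<longrightarrow> P y t"
      using bounded by (auto simp: S_def)
    then have "\<forall>\<^sub>F y in nhds x. y \<in> S k \<longrightarrow> P y t"
      by eventually_elim (simp add: S_def)
    then show "\<exists>t. \<forall>\<^sub>F y in nhds x. y \<in> S k \<longrightarrow> P y t" ..
  qed
  then obtain B where B: "\<And>k. B k \<ge> 0" "\<And>k x. x \<in> S k \<Longrightarrow> P x (B k)"
    by metis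
  have "\<exists>d>0. \<forall>x\<in>S k. H x < d \<longrightarrow> P x ((1/2)^k)" for k
  proof (rule eventually_on_compact_uniform[OF S])
    show "continuous_on (S k) H"
      using assms(2) by (rule continuous_on_subset) (simp add: S_def)
    fix x assume "x \<in> S k"
    then show "H x \<ge> 0" using H0 by (simp add: S_def)
    assume "H x = 0"
    then have "\<forall>\<^sub>F y in nhds x. y \<in> C \<longrightarrow> P y ((1/2)^k)"
      using boundary \<open>x \<in> S k\<close> by (simp add: S_def)
    then show "\<forall>\<^sub>F y in nhds x. y \<in> S k \<longrightarrow> P y ((1/2)^k)"
      by eventually_elim (simp add: S_def)
  qed
  then obtain d' where d': "\<And>k. d' k > 0" "\<And>k x. x \<in> S k \<Longrightarrow> H x < d' k \<Longrightarrow> P x ((1/2)^k)"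
    by metis
  \<comment> \<open>Cutting off at \<open>(1/2)^k\<close> makes the thresholds tend to \<open>0\<close>, so that every positive value of
    \<open>H\<close> lies above one of them.\<close>
  define d where "d k = min (d' k) ((1/2)^k)" for k
  have d: "d k > 0" for k
    using d' by (simp add: d_def)
  obtain \<gamma> where \<gamma>: "continuous_on UNIV \<gamma>" "strict_mono \<gamma>" "\<And>r. r \<le> 0 \<Longrightarrow> \<gamma> r = r"
      "\<And>r. \<gamma> r \<ge> r" "\<And>k r. d k \<le> r \<Longrightarrow> (1/2)^k \<le> \<gamma> r"
    using strict_mono_function_above_dyadic_steps[of d, OF d] by blast
  define K where "K j = max 2 (B (Suc j) * 2 ^ Suc j)" for j
  have "K j \<ge> 0" for j
    by (simp add: K_def)
  then obtain \<psi> where \<psi>: "continuous_on UNIV \<psi>" "strict_mono \<psi>" "\<And>s. s \<ge> 0 \<Longrightarrow> \<psi> s \<ge> 1"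
      "\<And>j s. real j \<le> s \<Longrightarrow> K j \<le> \<psi> s"
    using strict_mono_function_above_nat_values[of K] by blast
  have "P x (\<gamma> (H x) * \<psi> (norm x))" if x: "x \<in> C" for x
  proof (cases "H x = 0")
    case True
    then show ?thesis using zero[OF x] \<gamma>(3)[of 0] by simp
  next
    case False
    then have pos: "H x > 0" using H0[OF x] by simp
    then have \<gamma>pos: "\<gamma> (H x) > 0" using \<gamma>(4)[of "H x"] by simp
    define j where "j = nat \<lfloor>norm x\<rfloor>"
    have j: "real j \<le> norm x" "norm x \<le> real (Suc j)"
      unfolding j_def using norm_ge_zero[of x] by linarith+
    have xS: "x \<in> S k" if "k \<ge> Suc j" for k
      using x j that by (simp add: S_def)
    obtain n where "(1/2)^n < H x"
      using real_arch_pow_inv[OF pos, of "1/2"] by auto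
    then have n: "d n \<le> H x" by (simp add: d_def min_le_iff_disj)
    define k where "k = (LEAST k. d k \<le> H x)"
    have dk: "d k \<le> H x" unfolding k_def using n by (rule LeastI)
    have \<gamma>k: "(1/2)^k \<le> \<gamma> (H x)" using \<gamma>(5) dk by blast
    have "P x (\<gamma> (H x) * K j)"
    proof (cases "k \<le> Suc j")
      case True
      have "B (Suc j) = (1/2)^Suc j * (B (Suc j) * 2 ^ Suc j)"
        by (simp add: power_one_over)
      also have "\<dots> \<le> \<gamma> (H x) * K j"
      proof (rule mult_mono)
        have "(1/2)^Suc j \<le> ((1/2)^k :: real)"
          using True by (intro power_decreasing) auto
        then show "(1/2)^Suc j \<le> \<gamma> (H x)" using \<gamma>k by simp
      qed (use B(1)[of "Suc j"] \<gamma>pos in \<open>auto simp: K_def\<close>)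
      finally show ?thesis using mono B(2) xS by blast
    next
      case False
      then obtain i where i: "k = Suc i" "i \<ge> Suc j"
        by (cases k) auto
      have "\<not> d i \<le> H x"
        using not_less_Least[of i "\<lambda>k. d k \<le> H x"] i(1) by (simp add: k_def)
      then have "P x ((1/2)^i)"
        using d'(2) xS[OF i(2)] by (simp add: d_def)
      moreover have "(1/2)^i = (1/2)^k * (2::real)"
        by (simp add: i(1))
      then have "(1/2)^i \<le> \<gamma> (H x) * K j"
        using mult_mono[OF \<gamma>k, of 2 "K j"] \<gamma>pos by (simp add: K_def)
      ultimately show ?thesis using mono by blast
    qed
    moreover have "\<gamma> (H x) * K j \<le> \<gamma> (H x) * \<psi> (norm x)"
      using \<psi>(4)[OF j(1)] \<gamma>pos by simp
    ultimately show ?thesis using mono by blast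
  qed
  then show ?thesis
    using extended_class_KinfK_product[OF \<gamma>(1-4) \<psi>(1-3)] by blast
qed

section \<open>Compatible pairs\<close>

lemma gradient_eq_0_at_minimum:
  fixes V :: "'a::euclidean_space \<Rightarrow> real"
  assumes "open S" "x \<in> S" "V differentiable (at x)" "\<And>y. y \<in> S \<Longrightarrow> V x \<le> V y"
  shows "gradient V x = 0"
proof -
  have "(V has_derivative (\<lambda>v. v \<bullet> gradient V x)) (at x)"
    using gradient_GDERIV[OF assms(3)] by (simp add: gderiv_def)
  then have "(\<lambda>v. v \<bullet> gradient V x) = (\<lambda>v. 0)"
    using differential_zero_maxmin[OF assms(2,1)] assms(4) by blast
  then show ?thesis
    by (metis inner_eq_zero_iff)
qed

text \<open>
  \<open>W\<close> is subject to no continuity requirement, so on \<open>C\<close> it may be defined as the decrease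
  that the chosen controls achieve.  At the origin the gradient of \<open>V\<close> vanishes, so that any control
  satisfies the CLF inequality with \<open>W 0 = 0\<close>.
\<close>

lemma clf_reassign_W:
  assumes clf: "is_clf_with a g \<Gamma> V W" and "open \<Gamma>" "C \<subseteq> \<Gamma>"
    and ex: "\<And>x. x \<in> C \<Longrightarrow> \<exists>u. (x \<noteq> 0 \<longrightarrow> gradient V x \<bullet> control_affine a g x u < 0) \<and> R x u"
  shows "\<exists>W'. is_clf_with a g \<Gamma> V W' \<and> (\<forall>x\<in>C. \<exists>u. clf_ineq a g V W' x u \<and> R x u)"
proof -
  obtain u where u: "\<And>x. x \<in> C \<Longrightarrow> x \<noteq> 0 \<Longrightarrow> gradient V x \<bullet> control_affine a g x (u x) < 0"
      "\<And>x. x \<in> C \<Longrightarrow> R x (u x)"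
    using ex by metis
  define W' where
    "W' x = (if x \<in> C - {0} then - (gradient V x \<bullet> control_affine a g x (u x)) else W x)" for x
  have W: "W 0 = 0" "\<And>x. x \<in> \<Gamma> \<Longrightarrow> x \<noteq> 0 \<Longrightarrow> W x > 0"
      "\<And>x. x \<in> \<Gamma> \<Longrightarrow> x \<noteq> 0 \<Longrightarrow> \<exists>u. clf_ineq a g V W x u"
    using clf by (auto simp: is_clf_with_def positive_definite_on_def)
  have "positive_definite_on \<Gamma> W'"
    using W u(1) by (simp add: W'_def positive_definite_on_def)
  moreover have "\<exists>u. clf_ineq a g V W' x u" if "x \<in> \<Gamma>" "x \<noteq> 0" for x
  proof (cases "x \<in> C")
    case True
    then show ?thesis using that by (auto simp: clf_ineq_def W'_def)
  next
    case False
    then show ?thesis using W(3)[OF that] by (simp add: clf_ineq_def W'_def)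
  qed
  ultimately have "is_clf_with a g \<Gamma> V W'"
    using clf by (simp add: is_clf_with_def)
  moreover have "clf_ineq a g V W' x (u x)" if "x \<in> C" for x
  proof (cases "x = 0")
    case True
    have "0 \<in> \<Gamma>" "V differentiable (at 0)" "\<And>y. y \<in> \<Gamma> \<Longrightarrow> V 0 \<le> V y"
      using clf by (auto simp: is_clf_with_def C1_on_def positive_definite_on_def intro: less_imp_le)
    then have "gradient V 0 = 0"
      using gradient_eq_0_at_minimum assms(2) by blast
    then show ?thesis
      using True W(1) by (simp add: clf_ineq_def W'_def)
  next
    case False
    then show ?thesis using that by (simp add: clf_ineq_def W'_def)
  qed
  ultimately show ?thesis
    using u(2) by blast
qed

theorem propositionV6:
  fixes a :: "real^'n \<Rightarrow> real^'n" and g :: "real^'n \<Rightarrow> real^'m^'n"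
    and C \<Gamma> :: "(real^'n) set" and h V :: "real^'n \<Rightarrow> real"
  assumes "locally_lipschitz a" and "locally_lipschitz g"
    and "0 \<in> interior C"
    and "open \<Gamma>" and "C \<subseteq> \<Gamma>"
    and "is_ecbf a g C h" and "regular_value_0 h"
    and "is_clf a g \<Gamma> V"
    and "lie_parallel_set g \<Gamma> V h \<inter> frontier C \<subseteq>
           {x \<in> frontier C. lie_g g h x \<noteq> 0 \<and>
              lie_a a V x < (lie_g g V x \<bullet> lie_g g h x) / (norm (lie_g g h x))\<^sup>2 * lie_a a h x}"
  shows "\<exists>V' h'. compatible_pair a g C V' h' \<and> regular_value_0 h'"
proof -
  obtain \<alpha>0 where ecbf: "is_ecbf_with a g C h \<alpha>0"
    using assms(6) by (auto simp: is_ecbf_def)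
  then have hdiff: "h differentiable (at x)" and grad_h: "continuous_on UNIV (gradient h)"
    and C: "C = {x. h x \<ge> 0}" "frontier C = {x. h x = 0}" "interior C = {x. h x > 0}"
    and \<alpha>0: "s \<ge> 0 \<Longrightarrow> \<alpha>0 0 s = 0"
    and ecbf_u: "y \<in> C \<Longrightarrow> \<exists>u. ecbf_ineq a g h \<alpha>0 y u" for x y s
    by (auto simp: is_ecbf_with_def C1_on_def extended_class_KinfK_def)
  obtain W where clf: "is_clf_with a g \<Gamma> V W"
    using assms(8) by (auto simp: is_clf_def)
  then have grad_V: "continuous_on \<Gamma> (gradient V)"
    by (simp add: is_clf_with_def C1_on_def)
  have h_cont: "continuous_on UNIV h"
    using hdiff by (simp add: continuous_at_imp_continuous_on differentiable_imp_continuous_within)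
  have a: "continuous_on S a" and g: "continuous_on S g" for S
    using assms(1,2) locally_lipschitz_imp_continuous_on by blast+
  define VV where "VV x u = gradient V x \<bullet> control_affine a g x u" for x u
  define hh where "hh x u = gradient h x \<bullet> control_affine a g x u" for x u
  have VV_cont: "continuous_on \<Gamma> (\<lambda>x. VV x u)" for u
    unfolding VV_def using continuous_on_closed_loop_derivative[OF grad_V a g] .
  have hh_cont: "continuous_on UNIV (\<lambda>x. hh x u)" for u
    unfolding hh_def using continuous_on_closed_loop_derivative[OF grad_h a g] .
  have V_strict: "\<exists>u. VV x u < 0" if x: "x \<in> C" "x \<noteq> 0" for x
  proof -
    have "x \<in> \<Gamma>" using x(1) assms(5) by blast
    then have "W x > 0" "\<exists>u. VV x u \<le> - W x"
      using clf x(2) by (auto simp: is_clf_with_def positive_definite_on_def clf_ineq_def VV_def)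
    then show ?thesis
      by (metis le_less_trans neg_less_0_iff_less)
  qed
  have compat_bd: "\<exists>u. VV x u < 0 \<and> hh x u \<ge> 0" if hx: "h x = 0" for x
  proof -
    have x: "x \<in> C" "x \<in> frontier C" "x \<noteq> 0"
      using hx C assms(3) by auto
    have "\<exists>u. lie_a a V x + lie_g g V x \<bullet> u < 0"
      using V_strict[OF x(1,3)] by (simp add: VV_def gradient_control_affine)
    moreover have "\<exists>u. lie_a a h x + lie_g g h x \<bullet> u \<ge> 0"
      using ecbf_u[OF x(1)] \<alpha>0[of "norm x"] hx by (simp add: ecbf_ineq_def gradient_control_affine)
    moreover have "lie_g g h x \<noteq> 0 \<and>
        lie_a a V x < (lie_g g V x \<bullet> lie_g g h x) / (norm (lie_g g h x))\<^sup>2 * lie_a a h x"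
      if "\<kappa> > 0" "lie_g g V x = \<kappa> *\<^sub>R lie_g g h x" for \<kappa>
    proof -
      have "x \<in> lie_parallel_set g \<Gamma> V h \<inter> frontier C"
        using that x assms(5) by (auto simp: lie_parallel_set_def)
      then show ?thesis using assms(9) by blast
    qed
    ultimately show ?thesis
      unfolding VV_def hh_def gradient_control_affine
      by (rule strict_and_nonstrict_halfspace_intersect)
  qed

  \<comment> \<open>The level \<open>c\<close> lies below \<open>h 0\<close>, so the flattened function is constant near the origin.\<close>
  define c where "c = h 0 / 2"
  have c: "c > 0" "c < h 0"
    using assms(3) C by (auto simp: c_def)
  define h' where "h' x = flatten c (h x)" for x
  define w where "w x = 2 * max 0 (c - h x)" for x
  have h'_grad: "GDERIV h' x :> w x *\<^sub>R gradient h x" for x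
    unfolding h'_def[abs_def] w_def using GDERIV_flatten[OF hdiff] .
  have gradient_h': "gradient h' x = w x *\<^sub>R gradient h x" for x
    using gradient_eqI[OF h'_grad] .
  have w_cont: "continuous_on UNIV w"
    unfolding w_def using h_cont by (intro continuous_intros)
  have h'_diff: "h' differentiable (at x)" for x
    using h'_grad[of x] by (auto simp: gderiv_def differentiable_def)
  have h'_cont: "continuous_on UNIV h'"
    using h'_diff by (simp add: continuous_at_imp_continuous_on differentiable_imp_continuous_within)
  have h'_ge: "h' x \<ge> 0 \<longleftrightarrow> h x \<ge> 0" and h'_eq: "h' x = 0 \<longleftrightarrow> h x = 0" for x
    using flatten_nonneg_iff[OF c(1)] flatten_eq_0_iff[OF c(1)] by (simp_all add: h'_def)
  have h'_gt: "h' x > 0 \<longleftrightarrow> h x > 0" for x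
    using h'_ge[of x] h'_eq[of x] by linarith
  have h'_control: "gradient h' x \<bullet> control_affine a g x u = w x * hh x u" for x u
    by (simp add: gradient_h' hh_def)

  \<comment> \<open>\<open>P x t\<close> says that \<open>t\<close> is an admissible rate of decrease of \<open>h'\<close> at \<open>x\<close>.\<close>
  define P where "P x t \<longleftrightarrow> (\<exists>u. (x \<noteq> 0 \<longrightarrow> VV x u < 0) \<and> w x * hh x u \<ge> - t)" for x t
  have P_near: "\<forall>\<^sub>F y in nhds x. y \<in> C \<longrightarrow> P y t"
    if x: "x \<in> C" and u: "VV x u < 0" "w x * hh x u > - t" for x u t
  proof -
    have "x \<in> \<Gamma>" using x assms(5) by blast
    have "\<forall>\<^sub>F y in nhds x. VV y u < 0"
    proof -
      have "isCont (\<lambda>y. VV y u) x"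
        using VV_cont \<open>x \<in> \<Gamma>\<close> assms(4) by (simp add: continuous_on_eq_continuous_at)
      then show ?thesis
        using u(1) tendsto_at_iff_tendsto_nhds[of "\<lambda>y. VV y u" x]
        by (auto simp: isCont_def intro: order_tendstoD)
    qed
    moreover have "\<forall>\<^sub>F y in nhds x. w y * hh y u > - t"
    proof -
      have "isCont (\<lambda>y. w y * hh y u) x"
        using w_cont hh_cont by (intro continuous_intros) (simp_all add: continuous_on_eq_continuous_at)
      then show ?thesis
        using u(2) tendsto_at_iff_tendsto_nhds[of "\<lambda>y. w y * hh y u" x]
        by (auto simp: isCont_def intro: order_tendstoD)
    qed
    ultimately show ?thesis
      by eventually_elim (auto simp: P_def intro!: exI[of _ u])
  qed
  have "\<exists>\<alpha>. extended_class_KinfK \<alpha> \<and> (\<forall>x\<in>C. P x (\<alpha> (h' x) (norm x)))"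
  proof (rule extended_class_KinfK_majorant)
    show "closed C"
      unfolding C(1) using h_cont by (intro closed_Collect_le continuous_on_const)
    show "continuous_on C h'"
      using h'_cont by (rule continuous_on_subset) simp
    show "h' x \<ge> 0" if "x \<in> C" for x
      using that by (simp add: h'_ge C(1))
    show "P x t" if "P x s" "s \<le> t" for x s t
    proof -
      obtain u where "x \<noteq> 0 \<longrightarrow> VV x u < 0" "w x * hh x u \<ge> - s"
        using \<open>P x s\<close> unfolding P_def by blast
      then show ?thesis
        unfolding P_def using \<open>s \<le> t\<close> by (intro exI[of _ u]) auto
    qed
    show "\<exists>t. \<forall>\<^sub>F y in nhds x. y \<in> C \<longrightarrow> P y t" if "x \<in> C" for x
    proof (cases "x = 0")
      case True
      have "isCont h 0"
        using h_cont by (simp add: continuous_on_eq_continuous_at)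
      then have "\<forall>\<^sub>F y in nhds 0. h y > c"
        using c(2) by (auto simp: isCont_def tendsto_at_iff_tendsto_nhds intro: order_tendstoD)
      then have "\<forall>\<^sub>F y in nhds x. y \<in> C \<longrightarrow> P y 0"
        unfolding True
      proof eventually_elim
        case (elim y)
        then have "w y = 0" by (simp add: w_def)
        then show ?case using V_strict[of y] by (auto simp: P_def)
      qed
      then show ?thesis ..
    next
      case False
      then obtain u where u: "VV x u < 0" using V_strict \<open>x \<in> C\<close> by blast
      show ?thesis
        using P_near[OF \<open>x \<in> C\<close> u, of "1 - w x * hh x u"] by auto
    qed
    show "\<forall>\<^sub>F y in nhds x. y \<in> C \<longrightarrow> P y e" if "x \<in> C" "h' x = 0" "e > 0" for x e
    proof -
      obtain u where u: "VV x u < 0" "hh x u \<ge> 0"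
        using compat_bd h'_eq \<open>h' x = 0\<close> by blast
      then have "w x * hh x u \<ge> 0" by (simp add: w_def)
      then show ?thesis
        using P_near[OF \<open>x \<in> C\<close> u(1), of e] \<open>e > 0\<close> by simp
    qed
    show "P x 0" if "x \<in> C" "h' x = 0" for x
    proof -
      obtain u where u: "VV x u < 0" "hh x u \<ge> 0"
        using compat_bd h'_eq \<open>h' x = 0\<close> by blast
      then show ?thesis
        by (auto simp: P_def w_def intro!: exI[of _ u])
    qed
  qed
  then obtain \<alpha> where \<alpha>: "extended_class_KinfK \<alpha>" "\<And>x. x \<in> C \<Longrightarrow> P x (\<alpha> (h' x) (norm x))"
    by blast

  have both: "\<exists>u. (x \<noteq> 0 \<longrightarrow> gradient V x \<bullet> control_affine a g x u < 0) \<and> ecbf_ineq a g h' \<alpha> x u"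
    if "x \<in> C" for x
    using \<alpha>(2)[OF that] by (simp add: P_def VV_def ecbf_ineq_def h'_control)
  obtain W' where W': "is_clf_with a g \<Gamma> V W'"
      "\<forall>x\<in>C. \<exists>u. clf_ineq a g V W' x u \<and> ecbf_ineq a g h' \<alpha> x u"
    using clf_reassign_W[OF clf assms(4,5) both] by blast
  have "continuous_on UNIV (\<lambda>x. w x *\<^sub>R gradient h x)"
    using w_cont grad_h by (intro continuous_intros)
  then have "C1_on UNIV h'"
    using h'_diff by (simp add: C1_on_def gradient_h'[abs_def])
  moreover have "\<forall>x\<in>C. \<exists>u. ecbf_ineq a g h' \<alpha> x u"
    using both by blast
  ultimately have "is_ecbf_with a g C h' \<alpha>"
    using assms(3) C \<alpha>(1) unfolding is_ecbf_with_def h'_ge h'_eq h'_gt by blast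
  then have "compatible_pair a g C V h'"
    unfolding compatible_pair_def using W' assms(4,5) by blast
  moreover have "regular_value_0 h'"
    using assms(7) c(1) by (simp add: regular_value_0_def h'_eq gradient_h' w_def)
  ultimately show ?thesis by blast
qed

end
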